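(* Let $1\le m\le n$. There exists an encoding solving the 2D-RMQ problem on $m\times n$ arrays requiring at most $n\cdot\frac{m(m+3)}{2}$ bits (for every input array).
   Context: The input is an $m\times n$ array $A$ of elements from a totally ordered set, all entries distinct (identical entries are ordered lexicographically by index). The 2D-RMQ problem is to answer all queries of the form: given $q=[i_1\cdots i_2]\times[j_1\cdots j_2]$ with $1\le i_1\le i_2\le m$ (rows) and $1\le j_1\le j_2\le n$ (columns), return $\mathrm{RMQ}(A,q)=\mathrm{argmax}_{(i,j)\in q}A[i,j]$, the position of the maximum in the range. An encoding maps each array (of known dimensions) to a bit string so that all queries can be answered from the bit string alone, without access to $A$. *)

theory Defs
  imports Complex_Main "HOL-Library.FuncSet" "HOL-Library.Product_Lexorder"
begin

type_synonym cell = "nat \<times> nat"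

definition cells :: "nat \<Rightarrow> nat \<Rightarrow> cell set" where
  "cells m n = {1..m} \<times> {1..n}"

text \<open>Arrays are extensional functions, so they carry no information outside the index range.
  Entries may coincide; ties are broken in \<open>rmq\<close>.\<close>

definition arrays :: "nat \<Rightarrow> nat \<Rightarrow> (cell \<Rightarrow> 'a) set" where
  "arrays m n = cells m n \<rightarrow>\<^sub>E UNIV"

definition queries :: "nat \<Rightarrow> nat \<Rightarrow> cell set set" where
  "queries m n = {{i1..i2} \<times> {j1..j2} | i1 i2 j1 j2.
     1 \<le> i1 \<and> i1 \<le> i2 \<and> i2 \<le> m \<and> 1 \<le> j1 \<and> j1 \<le> j2 \<and> j2 \<le> n}"

text \<open>Products are ordered lexicographically, so equal entries are compared by their row index
  and then by their column index; for pairwise distinct entries this is the argmax of \<open>A\<close>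
  (see \<open>rmq_eq_iff_distinct\<close>).\<close>

definition rmq :: "(cell \<Rightarrow> 'a::linorder) \<Rightarrow> cell set \<Rightarrow> cell" where
  "rmq A q = (ARG_MAX (\<lambda>p. (A p, p)) p. p \<in> q)"

text \<open>The decoder receives only the bit string and the query. It may depend on the
  dimensions, but not on the array.\<close>

definition solves_2d_rmq ::
  "nat \<Rightarrow> nat \<Rightarrow> ((cell \<Rightarrow> 'a::linorder) \<Rightarrow> bool list) \<Rightarrow> bool" where
  "solves_2d_rmq m n enc \<longleftrightarrow>
     (\<exists>dec :: bool list \<Rightarrow> cell set \<Rightarrow> cell.
        \<forall>A \<in> arrays m n. \<forall>q \<in> queries m n. dec (enc A) q = rmq A q)"

lemma rmq_eq_iff:
  fixes A :: "cell \<Rightarrow> 'a::linorder"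
  assumes "finite q" "q \<noteq> {}"
  shows "rmq A q = p \<longleftrightarrow> p \<in> q \<and> (\<forall>p' \<in> q. (A p', p') \<le> (A p, p))"
proof -
  define f where "f = (\<lambda>p. (A p, p))"
  have "Max (f ` q) \<in> f ` q"
    using assms by (intro Max_in) auto
  then obtain r where r: "r \<in> q" "Max (f ` q) = f r"
    by blast
  have max: "f p' \<le> f r" if "p' \<in> q" for p'
    using Max_ge[of "f ` q" "f p'"] assms that by (simp add: r(2))
  have uniq: "x = r" if "x \<in> q" "\<forall>p' \<in> q. f p' \<le> f x" for x
  proof -
    have "f x = f r"
      using that(2) r(1) max[OF that(1)] by (blast intro: antisym)
    then show ?thesis by (simp add: f_def)
  qed
  have "rmq A q = r"
    unfolding rmq_def arg_max_def f_def[symmetric]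
  proof (rule some_equality)
    show "is_arg_max f (\<lambda>p. p \<in> q) r"
      unfolding is_arg_max_linorder using r(1) max by blast
  next
    fix x assume "is_arg_max f (\<lambda>p. p \<in> q) x"
    then show "x = r"
      unfolding is_arg_max_linorder by (intro uniq) blast+
  qed
  then show ?thesis
    using r(1) max uniq unfolding f_def by blast
qed

lemma rmq_eq_iff_distinct:
  fixes A :: "cell \<Rightarrow> 'a::linorder"
  assumes "finite q" "q \<noteq> {}" "inj_on A q"
  shows "rmq A q = p \<longleftrightarrow> p \<in> q \<and> (\<forall>p' \<in> q. A p' \<le> A p)"
proof -
  have "(A p', p') \<le> (A p, p) \<longleftrightarrow> A p' \<le> A p" if "p \<in> q" "p' \<in> q" for p'
    using inj_onD[OF assms(3) _ that(2) that(1)]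
    by (cases "A p' = A p") (auto simp: less_eq_prod_def less_le)
  then show ?thesis
    using rmq_eq_iff[OF assms(1,2)] by blast
qed

end

theory Submission
  imports Defs "HOL-Library.Tree"
begin

text \<open>For a row interval, the Cartesian tree over the columns (root: position of the maximum;
  subtrees: the columns to its left and to its right) determines all queries spanning exactly these
  rows. For a single row the shape of the tree suffices, which costs \<open>2 * n\<close> bits. For the rows
  \<open>a..b\<close> with \<open>a < b\<close>, the maximum over any column range is the maximum for the rows \<open>a..b - 1\<close>
  or for the rows \<open>a + 1..b\<close>, and one bit says which. Listing these bits in preorder costs \<open>n\<close> bits
  per pair \<open>a < b\<close>, since each choice fixes the column at which the range is split. In
  total this is \<open>2 * m * n + n * (m choose 2) = n * m * (m + 3) / 2\<close> bits.\<close>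

section \<open>Maxima over row slabs and their Cartesian trees\<close>

lemma rmq_in:
  assumes "finite q" "q \<noteq> {}"
  shows "rmq A q \<in> q"
  using rmq_eq_iff[OF assms] by blast

lemma rmq_subset:
  assumes "finite q" "q' \<subseteq> q" "rmq A q \<in> q'"
  shows "rmq A q' = rmq A q"
proof -
  have "finite q'" "q' \<noteq> {}" "q \<noteq> {}"
    using assms finite_subset by auto
  then show ?thesis
    using rmq_eq_iff[of q] rmq_eq_iff[of q'] assms by (meson subsetD)
qed

lemma rmq_slab_in:
  assumes "finite R" "R \<noteq> {}" "l < r"
  shows "fst (rmq A (R \<times> {l..<r})) \<in> R" "snd (rmq A (R \<times> {l..<r})) \<in> {l..<r}"
  using rmq_in[of "R \<times> {l..<r}" A] assms by (auto simp: mem_Times_iff)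

text \<open>Column ranges are half-open, so the range left of the root needs no predecessor. The
  guard puts the maximum inside the slab, on which termination rests. Nodes store whole cells, since
  with several rows a column alone answers no query.\<close>

function ctree :: "(cell \<Rightarrow> 'a::linorder) \<Rightarrow> nat set \<Rightarrow> nat \<Rightarrow> nat \<Rightarrow> cell tree" where
  "ctree A R l r =
     (if finite R \<and> R \<noteq> {} \<and> l < r
      then let p = rmq A (R \<times> {l..<r})
           in Node (ctree A R l (snd p)) p (ctree A R (Suc (snd p)) r)
      else Leaf)"
  by pat_completeness auto
termination
proof (relation "measure (\<lambda>(A, R, l, r). r - l)", goal_cases)
  case (2 A R l r p)
  then show ?case using rmq_slab_in(2)[of R l r A] unfolding 2(2) by (simp del: Times_empty) linarith
next
  case (3 A R l r p)
  then show ?case using rmq_slab_in(2)[of R l r A] unfolding 3(2) by (simp del: Times_empty) linarith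
qed simp

declare ctree.simps [simp del]

lemma ctree_Leaf: "r \<le> l \<Longrightarrow> ctree A R l r = Leaf"
  by (subst ctree.simps) auto

lemma ctree_Node:
  assumes "finite R" "R \<noteq> {}" "l < r"
  shows "ctree A R l r =
    Node (ctree A R l (snd (rmq A (R \<times> {l..<r})))) (rmq A (R \<times> {l..<r}))
         (ctree A R (Suc (snd (rmq A (R \<times> {l..<r})))) r)"
  using assms by (subst ctree.simps) (auto simp: Let_def)

lemma size_ctree:
  assumes "finite R" "R \<noteq> {}"
  shows "size (ctree A R l r) = r - l"
proof (induction "r - l" arbitrary: l r rule: less_induct)
  case less
  show ?case
  proof (cases "l < r")
    case True
    then show ?thesis
      using less[of "snd (rmq A (R \<times> {l..<r}))" l] less[of r "Suc (snd (rmq A (R \<times> {l..<r})))"]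
        rmq_slab_in(2)[OF assms True, of A] ctree_Node[OF assms True, of A]
      by auto
  qed (simp add: ctree_Leaf)
qed

section \<open>Arrays that agree on all column ranges of a slab\<close>

text \<open>Correctness is stated as injectivity: two arrays with equal codes must give equal
  answers. Hence arrays are compared in pairs.\<close>

definition same_rmq ::
  "(cell \<Rightarrow> 'a::linorder) \<Rightarrow> (cell \<Rightarrow> 'a) \<Rightarrow> nat set \<Rightarrow> nat \<Rightarrow> nat \<Rightarrow> bool" where
  "same_rmq A B R l r \<longleftrightarrow>
     (\<forall>l' r'. l \<le> l' \<and> l' < r' \<and> r' \<le> r \<longrightarrow> rmq A (R \<times> {l'..<r'}) = rmq B (R \<times> {l'..<r'}))"

lemma same_rmqD:
  "same_rmq A B R l r \<Longrightarrow> l \<le> l' \<Longrightarrow> l' < r' \<Longrightarrow> r' \<le> r \<Longrightarrow>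
    rmq A (R \<times> {l'..<r'}) = rmq B (R \<times> {l'..<r'})"
  by (auto simp: same_rmq_def)

lemma same_rmq_mono: "same_rmq A B R l r \<Longrightarrow> l \<le> l' \<Longrightarrow> r' \<le> r \<Longrightarrow> same_rmq A B R l' r'"
  by (auto simp: same_rmq_def)

text \<open>A column range on one side of the root column is left to a subtree. A range containing
  that column contains the root cell, which stays the maximum by \<open>rmq_subset\<close>.\<close>

lemma same_rmq_if_ctree_eq:
  assumes R: "finite R" "R \<noteq> {}"
  shows "ctree A R l r = ctree B R l r \<Longrightarrow> same_rmq A B R l r"
proof (induction "r - l" arbitrary: l r rule: less_induct)
  case less
  show ?case
  proof (cases "l < r")
    case True
    define p where "p = rmq A (R \<times> {l..<r})"
    have p: "fst p \<in> R" "l \<le> snd p" "snd p < r"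
      using rmq_slab_in[OF R True, of A] by (auto simp: p_def)
    have pB: "p = rmq B (R \<times> {l..<r})"
      and "ctree A R l (snd p) = ctree B R l (snd p)"
      and "ctree A R (Suc (snd p)) r = ctree B R (Suc (snd p)) r"
      using less.prems unfolding ctree_Node[OF R True] p_def by auto
    then have left: "same_rmq A B R l (snd p)" and right: "same_rmq A B R (Suc (snd p)) r"
      using less.hyps p by auto
    show ?thesis
      unfolding same_rmq_def
    proof (intro allI impI)
      fix l' r' assume lr: "l \<le> l' \<and> l' < r' \<and> r' \<le> r"
      consider "r' \<le> snd p" | "Suc (snd p) \<le> l'" | "l' \<le> snd p" "snd p < r'"
        by linarith
      then show "rmq A (R \<times> {l'..<r'}) = rmq B (R \<times> {l'..<r'})"
      proof cases
        case 3
        then have "p \<in> R \<times> {l'..<r'}"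
          using p by (auto simp: mem_Times_iff)
        moreover have "R \<times> {l'..<r'} \<subseteq> R \<times> {l..<r}"
          using lr by auto
        ultimately show ?thesis
          using rmq_subset[of "R \<times> {l..<r}" "R \<times> {l'..<r'}" A]
            rmq_subset[of "R \<times> {l..<r}" "R \<times> {l'..<r'}" B] R pB p_def
          by (metis finite_SigmaI finite_atLeastLessThan)
      qed (use lr same_rmqD[OF left] same_rmqD[OF right] in auto)
    qed
  qed (auto simp: same_rmq_def)
qed

section \<open>Tree shapes and single rows\<close>

fun shape_bits :: "'b tree \<Rightarrow> bool list" where
  "shape_bits Leaf = [False]"
| "shape_bits (Node s x t) = True # shape_bits s @ shape_bits t"

lemma length_shape_bits: "length (shape_bits t) = Suc (2 * size t)"
  by (induction t) auto

text \<open>The suffixes \<open>xs\<close> and \<open>ys\<close> carry the induction: for the left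
  subtree, the suffix is the code of the right subtree followed by the rest.\<close>

lemma shape_bits_prefix_free:
  "shape_bits s @ xs = shape_bits t @ ys \<Longrightarrow>
    map_tree (\<lambda>_. ()) s = map_tree (\<lambda>_. ()) t \<and> xs = ys"
proof (induction s arbitrary: t xs ys)
  case Leaf
  then show ?case by (cases t) auto
next
  case (Node s1 x s2)
  from Node.prems have "t \<noteq> Leaf"
    by auto
  then obtain t1 y t2 where t: "t = Node t1 y t2"
    by (meson tree.exhaust)
  have "shape_bits s1 @ shape_bits s2 @ xs = shape_bits t1 @ shape_bits t2 @ ys"
    using Node.prems by (simp add: t)
  from Node.IH(1)[OF this] Node.IH(2)[of xs t2 ys] show ?case
    by (simp add: t)
qed

lemma shape_bits_snoc: "shape_bits t = butlast (shape_bits t) @ [False]"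
proof -
  have "shape_bits t \<noteq> [] \<and> last (shape_bits t) = False"
    by (induction t) auto
  then show ?thesis
    by (metis append_butlast_last_id)
qed

lemma shape_eq_if_butlast_shape_bits_eq:
  assumes "butlast (shape_bits s) = butlast (shape_bits t)"
  shows "map_tree (\<lambda>_. ()) s = map_tree (\<lambda>_. ()) t"
proof -
  have "shape_bits s = shape_bits t"
    using arg_cong[OF assms, of "\<lambda>xs. xs @ [False]"] by (simp only: shape_bits_snoc[symmetric])
  then show ?thesis
    using shape_bits_prefix_free[of s "[]" t "[]"] by simp
qed

lemma ctree_row_eq_if_shape_eq:
  "map_tree (\<lambda>_. ()) (ctree A {i} l r) = map_tree (\<lambda>_. ()) (ctree B {i} l r) \<Longrightarrow>
    ctree A {i} l r = ctree B {i} l r"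
proof (induction "r - l" arbitrary: l r rule: less_induct)
  case less
  show ?case
  proof (cases "l < r")
    case True
    define p where "p = rmq A ({i} \<times> {l..<r})"
    define p' where "p' = rmq B ({i} \<times> {l..<r})"
    have p: "fst p = i" "l \<le> snd p" "snd p < r" and p': "fst p' = i" "l \<le> snd p'"
      using rmq_slab_in[of "{i}", OF _ _ True] by (auto simp: p_def p'_def)
    have A: "ctree A {i} l r = Node (ctree A {i} l (snd p)) p (ctree A {i} (Suc (snd p)) r)"
      and B: "ctree B {i} l r = Node (ctree B {i} l (snd p')) p' (ctree B {i} (Suc (snd p')) r)"
      using ctree_Node[of "{i}", OF _ _ True] by (auto simp: p_def p'_def)
    have left: "map_tree (\<lambda>_. ()) (ctree A {i} l (snd p)) = map_tree (\<lambda>_. ()) (ctree B {i} l (snd p'))"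
      and right: "map_tree (\<lambda>_. ()) (ctree A {i} (Suc (snd p)) r) =
        map_tree (\<lambda>_. ()) (ctree B {i} (Suc (snd p')) r)"
      using less.prems A B by auto
    \<comment> \<open>The size of the left subtree is the offset of the root column; with only row
      \<open>i\<close>, this fixes the root cell.\<close>
    have "snd p - l = snd p' - l"
      using arg_cong[OF left, of size] by (simp add: size_ctree)
    then have "p = p'"
      using p p' by (simp add: prod_eq_iff)
    then show ?thesis
      using A B p less.hyps[of "snd p" l] less.hyps[of r "Suc (snd p)"] left right by auto
  qed (simp add: ctree_Leaf)
qed

section \<open>Merging two overlapping row intervals\<close>

text \<open>Meant for trees over rows ending in \<open>Suc b\<close>: \<open>True\<close> says that
  the maximum avoids the last row.\<close>

definition merge_bits :: "nat \<Rightarrow> cell tree \<Rightarrow> bool list" where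
  "merge_bits b t = map (\<lambda>p. fst p \<le> b) (preorder t)"

lemma merge_bits_Node: "merge_bits b (Node s p t) = (fst p \<le> b) # merge_bits b s @ merge_bits b t"
  by (simp add: merge_bits_def)

lemma length_merge_bits: "length (merge_bits b t) = size t"
  by (simp add: merge_bits_def)

lemma ctree_eq_if_merge_bits_eq:
  assumes "a \<le> b"
  shows "same_rmq A B {a..b} l r \<Longrightarrow> same_rmq A B {Suc a..Suc b} l r \<Longrightarrow>
    merge_bits b (ctree A {a..Suc b} l r) = merge_bits b (ctree B {a..Suc b} l r) \<Longrightarrow>
    ctree A {a..Suc b} l r = ctree B {a..Suc b} l r"
proof (induction "r - l" arbitrary: l r rule: less_induct)
  case less
  let ?R = "{a..Suc b}"
  have R: "finite ?R" "?R \<noteq> {}"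
    using assms by auto
  show ?case
  proof (cases "l < r")
    case True
    define p where "p = rmq A (?R \<times> {l..<r})"
    define p' where "p' = rmq B (?R \<times> {l..<r})"
    have p: "fst p \<in> ?R" "snd p \<in> {l..<r}" and p': "fst p' \<in> ?R" "snd p' \<in> {l..<r}"
      using rmq_slab_in[OF R True] by (auto simp: p_def p'_def)
    have A: "ctree A ?R l r = Node (ctree A ?R l (snd p)) p (ctree A ?R (Suc (snd p)) r)"
      and B: "ctree B ?R l r = Node (ctree B ?R l (snd p')) p' (ctree B ?R (Suc (snd p')) r)"
      using ctree_Node[OF R True] by (auto simp: p_def p'_def)
    have bit: "fst p \<le> b \<longleftrightarrow> fst p' \<le> b"
      using less.prems(3) A B by (simp add: merge_bits_Node)
    \<comment> \<open>\<open>Q\<close> is the shorter interval that the bit selects for both arrays.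
      If the bit is \<open>False\<close>, both maxima lie in row \<open>Suc b\<close>, which belongs
      to \<open>{Suc a..Suc b}\<close> because \<open>a \<le> b\<close>.\<close>
    obtain Q where Q: "Q \<subseteq> ?R" "same_rmq A B Q l r" "fst p \<in> Q" "fst p' \<in> Q"
    proof (cases "fst p \<le> b")
      case True
      then show ?thesis
        using that[of "{a..b}"] less.prems(1) bit p p' by auto
    next
      case False
      then show ?thesis
        using that[of "{Suc a..Suc b}"] less.prems(2) bit p p' assms by auto
    qed
    have "rmq A (Q \<times> {l..<r}) = p" "rmq B (Q \<times> {l..<r}) = p'"
      using rmq_subset[of "?R \<times> {l..<r}" "Q \<times> {l..<r}"] Q p p'
      by (auto simp: p_def p'_def mem_Times_iff)
    then have eq: "p = p'"
      using same_rmqD[OF Q(2)] True by auto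
    \<comment> \<open>Equal roots give left subtrees of equal size, so both bit lists split at the
      same place.\<close>
    have "merge_bits b (ctree A ?R l (snd p)) = merge_bits b (ctree B ?R l (snd p))"
      "merge_bits b (ctree A ?R (Suc (snd p)) r) = merge_bits b (ctree B ?R (Suc (snd p)) r)"
      using less.prems(3) A B eq
      by (simp_all add: merge_bits_Node length_merge_bits size_ctree[OF R])
    then show ?thesis
      using A B eq p less.hyps[of "snd p" l] less.hyps[of r "Suc (snd p)"]
        same_rmq_mono[OF less.prems(1)] same_rmq_mono[OF less.prems(2)] by auto
  qed (simp add: ctree_Leaf)
qed

section \<open>The code, its length and its decoding\<close>

text \<open>A shape code has \<open>2 * n + 1\<close> bits and always ends in \<open>False\<close>; dropping this
  last bit gives the exact bound.\<close>

definition block :: "nat \<Rightarrow> (cell \<Rightarrow> 'a::linorder) \<Rightarrow> nat \<times> nat \<Rightarrow> bool list" where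
  "block n A = (\<lambda>(a, b).
     if a = b then butlast (shape_bits (ctree A {a} 1 (Suc n)))
     else merge_bits (b - 1) (ctree A {a..b} 1 (Suc n)))"

text \<open>With \<open>b\<close> in the outer loop, passing to \<open>Suc m\<close> only appends
  pairs, as the induction on \<open>m\<close> for the length requires.\<close>

definition row_pairs :: "nat \<Rightarrow> (nat \<times> nat) list" where
  "row_pairs m = concat (map (\<lambda>b. map (\<lambda>a. (a, b)) [1..<Suc b]) [1..<Suc m])"

definition rmq_code :: "nat \<Rightarrow> nat \<Rightarrow> (cell \<Rightarrow> 'a::linorder) \<Rightarrow> bool list" where
  "rmq_code m n A = concat (map (block n A) (row_pairs m))"

lemma set_row_pairs: "set (row_pairs m) = {(a, b). 1 \<le> a \<and> a \<le> b \<and> b \<le> m}"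
  by (auto simp: row_pairs_def image_iff simp del: upt_Suc)

lemma length_block: "a \<le> b \<Longrightarrow> length (block n A (a, b)) = (if a = b then 2 * n else n)"
  by (simp add: block_def length_shape_bits length_merge_bits size_ctree)

text \<open>Row \<open>Suc m\<close> adds \<open>m\<close> merge blocks of \<open>n\<close> bits and
  one shape block of \<open>2 * n\<close> bits. Doubling avoids division.\<close>

lemma length_rmq_code: "2 * length (rmq_code m n A) = n * (m * (m + 3))"
proof (induction m)
  case 0
  show ?case by (simp add: rmq_code_def row_pairs_def)
next
  case (Suc m)
  have "(\<Sum>a\<leftarrow>[1..<Suc m]. length (block n A (a, Suc m))) = (\<Sum>a\<leftarrow>[1..<Suc m]. n)"
    by (intro arg_cong[of _ _ sum_list] map_cong) (auto simp: length_block)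
  also have "\<dots> = m * n"
    by (simp add: sum_list_triv)
  finally have "length (rmq_code (Suc m) n A) = length (rmq_code m n A) + (m * n + 2 * n)"
    by (simp add: rmq_code_def row_pairs_def length_concat comp_def length_block)
  then show ?case
    using Suc by (simp add: algebra_simps)
qed

text \<open>Block lengths depend only on \<open>n\<close> and the pair, so the concatenation can be
  cut without separators.\<close>

lemma block_eq_if_rmq_code_eq:
  assumes "rmq_code m n A = rmq_code m n B" "1 \<le> a" "a \<le> b" "b \<le> m"
  shows "block n A (a, b) = block n B (a, b)"
proof -
  have "map (block n A) (row_pairs m) = map (block n B) (row_pairs m)"
  proof (rule concat_injective)
    show "concat (map (block n A) (row_pairs m)) = concat (map (block n B) (row_pairs m))"
      using assms(1) by (simp add: rmq_code_def)
    show "\<forall>(xs, ys) \<in> set (zip (map (block n A) (row_pairs m)) (map (block n B) (row_pairs m))).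
        length xs = length ys"
      by (auto simp: zip_map_map zip_same_conv_map length_block set_row_pairs)
  qed simp
  then show ?thesis
    using assms by (auto simp: set_row_pairs)
qed

text \<open>Induction on the number of rows beyond the first, with \<open>a\<close> arbitrary: the
  step merges the intervals of \<open>d + 1\<close> rows starting at \<open>a\<close> and at
  \<open>Suc a\<close>.\<close>

lemma same_rmq_if_rmq_code_eq:
  assumes "rmq_code m n A = rmq_code m n B" "1 \<le> a" "a + d \<le> m"
  shows "same_rmq A B {a..a + d} 1 (Suc n)"
  using assms(2,3)
proof (induction d arbitrary: a)
  case 0
  then have "butlast (shape_bits (ctree A {a} 1 (Suc n))) =
      butlast (shape_bits (ctree B {a} 1 (Suc n)))"
    using block_eq_if_rmq_code_eq[OF assms(1), of a a] by (simp add: block_def)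
  then have "ctree A {a} 1 (Suc n) = ctree B {a} 1 (Suc n)"
    by (intro ctree_row_eq_if_shape_eq shape_eq_if_butlast_shape_bits_eq)
  then show ?case
    using same_rmq_if_ctree_eq[of "{a}"] by simp
next
  case (Suc d)
  have "merge_bits (a + d) (ctree A {a..Suc (a + d)} 1 (Suc n)) =
      merge_bits (a + d) (ctree B {a..Suc (a + d)} 1 (Suc n))"
    using block_eq_if_rmq_code_eq[OF assms(1), of a "Suc (a + d)"] Suc.prems
    by (simp add: block_def)
  then have "ctree A {a..Suc (a + d)} 1 (Suc n) = ctree B {a..Suc (a + d)} 1 (Suc n)"
    using Suc.IH[of a] Suc.IH[of "Suc a"] Suc.prems by (intro ctree_eq_if_merge_bits_eq) auto
  then show ?case
    using same_rmq_if_ctree_eq[of "{a..Suc (a + d)}"] by simp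
qed

lemma rmq_eq_if_rmq_code_eq:
  fixes A B :: "cell \<Rightarrow> 'a::linorder"
  assumes "rmq_code m n A = rmq_code m n B" "q \<in> queries m n"
  shows "rmq A q = rmq B q"
proof -
  obtain i1 i2 j1 j2 where q: "q = {i1..i2} \<times> {j1..<Suc j2}"
    and ij: "1 \<le> i1" "i1 \<le> i2" "i2 \<le> m" "1 \<le> j1" "j1 \<le> j2" "j2 \<le> n"
    using assms(2) by (auto simp: queries_def atLeastLessThanSuc_atLeastAtMost)
  have "same_rmq A B {i1..i2} 1 (Suc n)"
    using same_rmq_if_rmq_code_eq[OF assms(1), of i1 "i2 - i1"] ij by simp
  then show ?thesis
    unfolding q by (rule same_rmqD) (use ij in auto)
qed

lemma solves_2d_rmq_rmq_code:
  "solves_2d_rmq m n (rmq_code m n :: (cell \<Rightarrow> 'a::linorder) \<Rightarrow> bool list)"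
proof -
  \<comment> \<open>The decoder picks any \<open>B\<close> with the given code; equal codes make its
    answers those of the encoded array.\<close>
  define dec where "dec = (\<lambda>bs. rmq (SOME B :: cell \<Rightarrow> 'a. rmq_code m n B = bs))"
  have "dec (rmq_code m n A) q = rmq A q" if "q \<in> queries m n" for A :: "cell \<Rightarrow> 'a" and q
  proof -
    have "rmq_code m n (SOME B :: cell \<Rightarrow> 'a. rmq_code m n B = rmq_code m n A) = rmq_code m n A"
      using someI[of "\<lambda>B. rmq_code m n B = rmq_code m n A" A] by blast
    from rmq_eq_if_rmq_code_eq[OF this that] show ?thesis
      by (simp only: dec_def)
  qed
  then show ?thesis
    unfolding solves_2d_rmq_def by blast
qed

theorem theorem6:
  fixes m n :: nat
  assumes "1 \<le> m" and "m \<le> n"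
  shows "\<exists>enc :: (nat \<times> nat \<Rightarrow> 'a::linorder) \<Rightarrow> bool list.
           solves_2d_rmq m n enc \<and>
           (\<forall>A \<in> arrays m n.
              real (length (enc A)) \<le> real n * ((real m * (real m + 3)) / 2))"
proof (intro exI conjI ballI)
  show "solves_2d_rmq m n (rmq_code m n :: (cell \<Rightarrow> 'a) \<Rightarrow> bool list)"
    by (rule solves_2d_rmq_rmq_code)
next
  fix A :: "cell \<Rightarrow> 'a"
  show "real (length (rmq_code m n A)) \<le> real n * ((real m * (real m + 3)) / 2)"
    using arg_cong[OF length_rmq_code[of m n A], of real] by simp
qed

end
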